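(* Every splitting can be realised by an application of a sequence of linkings to an augmented quiver. That is: let $Q=(C,\boldsymbol x)$ be a symmetric quiver with $m$ nodes, and consider any $(k,l)$-splitting of $Q$ ($k,l\in\mathbb Z$) of $n$ chosen nodes with permutation $\sigma\in S_n$, arbitrary integer shifts $h_s$ for the $m-n$ spectators, and multiplicative factor $\kappa$. Then there exist a symmetric quiver $Q^+$ consisting of $Q$ together with one extra node (with suitable generating parameter, number of loops, and numbers of arrows to the nodes of $Q$) and a finite sequence of linkings which, applied to $Q^+$, yields a quiver that after removing the extra node coincides (up to reordering of nodes) with the given $(k,l)$-splitting of $Q$, both in adjacency matrix and in generating parameters.
   Context: A symmetric quiver $Q=(C,\boldsymbol{x})$ is given by a symmetric integer matrix $C$ (negative entries allowed) whose rows are indexed by the nodes, together with a vector $\boldsymbol{x}$ assigning to each node $i$ a generating parameter $x_i$. $(k,l)$-splitting. Data: a quiver $(C,\boldsymbol x)$, $n$ ordered chosen nodes $v_1,\dots,v_n$, a permutation $\sigma\in S_n$, an integer shift $h_s$ for every remaining node $s$ (called a spectator), and a multiplicative factor $\kappa$. The result has the old nodes, with all mutual entries of $C$ and all parameters unchanged, and $n$ new nodes $v_1',\dots,v_n'$ with parameters $x_{v_a'}=\kappa x_{v_a}$ and symmetric entries $C_{s v_a'}=C_{sv_a}+h_s$; $C_{v_av_a'}=C_{v_av_a}+k$; $C_{v_a'v_b'}=C_{v_av_b}+l$ (including $a=b$); and for $a<b$: if $\sigma(a)<\sigma(b)$ then $C_{v_av_b'}=C_{v_av_b}+k$, $C_{v_a'v_b}=C_{v_av_b}+k+1$;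 if $\sigma(a)>\sigma(b)$ then $C_{v_av_b'}=C_{v_av_b}+k+1$, $C_{v_a'v_b}=C_{v_av_b}+k$. Linking $L(ij)$ of distinct nodes $i,j$ of a symmetric quiver: replace $C_{ij}=C_{ji}$ by $C_{ij}+1$, keep all other entries among old nodes and all old parameters, and add one new node $\nu$ with parameter $x_\nu=x_ix_j$ and (in terms of the old matrix $C$) symmetric entries $C_{t\nu}=C_{ti}+C_{tj}$ for $t\neq i,j$, $C_{i\nu}=C_{ii}+C_{ij}$, $C_{j\nu}=C_{ij}+C_{jj}$, $C_{\nu\nu}=C_{ii}+C_{jj}+2C_{ij}$. *)

theory Defs
  imports "Jordan_Normal_Form.Determinant" "HOL-Combinatorics.Permutations"
begin

(* A quiver with m nodes has node set {..<m}. The generating parameters live in an arbitrary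
   commutative monoid, since only products of parameters are ever formed. *)
type_synonym 'p quiver = "int mat \<times> 'p vec"

fun is_quiver :: "nat \<Rightarrow> 'p quiver \<Rightarrow> bool" where
  "is_quiver m (C, x) \<longleftrightarrow> C \<in> carrier_mat m m \<and> transpose_mat C = C \<and> x \<in> carrier_vec m"

(* Equality up to reordering of the nodes. *)
fun quiver_iso :: "'p quiver \<Rightarrow> 'p quiver \<Rightarrow> bool" where
  "quiver_iso (C, x) (D, y) \<longleftrightarrow>
     dim_row C = dim_vec x \<and> dim_col C = dim_vec x \<and>
     (\<exists>\<pi>. \<pi> permutes {..<dim_vec x} \<and>
          D = mat (dim_vec x) (dim_vec x) (\<lambda>(i, j). C $$ (\<pi> i, \<pi> j)) \<and>
          y = vec (dim_vec x) (\<lambda>i. x $ \<pi> i))"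

(* The node added to a quiver with m nodes gets index m; it has parameter y, c loops,
   and d t arrows to each old node t. *)
fun add_node :: "'p \<Rightarrow> int \<Rightarrow> (nat \<Rightarrow> int) \<Rightarrow> 'p quiver \<Rightarrow> 'p quiver" where
  "add_node y c d (C, x) =
     (let m = dim_vec x in
       (mat (Suc m) (Suc m)
          (\<lambda>(s, t). if s < m \<and> t < m then C $$ (s, t)
                     else if s < m then d s
                     else if t < m then d t
                     else c),
        vec (Suc m) (\<lambda>s. if s < m then x $ s else y)))"

(* Nodes with index above r move down by one. *)
fun remove_node :: "nat \<Rightarrow> 'p quiver \<Rightarrow> 'p quiver" where
  "remove_node r (C, x) =
     (mat_delete C r r, vec (dim_vec x - 1) (\<lambda>s. x $ insert_index r s))"

(* Everything on the right-hand side refers to the entries of C before the change of C_ij;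
   for symmetric C the arrow numbers C_ti + C_tj include the cases t = i (giving C_ii + C_ij)
   and t = j (giving C_ij + C_jj). *)
fun linking :: "nat \<Rightarrow> nat \<Rightarrow> 'p::comm_monoid_mult quiver \<Rightarrow> 'p quiver" where
  "linking i j (C, x) =
     add_node (x $ i * x $ j)
       (C $$ (i, i) + C $$ (j, j) + 2 * C $$ (i, j))
       (\<lambda>t. C $$ (t, i) + C $$ (t, j))
       (mat (dim_row C) (dim_col C)
          (\<lambda>(s, t). if (s, t) = (i, j) \<or> (s, t) = (j, i) then C $$ (s, t) + 1 else C $$ (s, t)),
        x)"

definition linking_step :: "'p::comm_monoid_mult quiver \<Rightarrow> 'p quiver \<Rightarrow> bool" where
  "linking_step Q R \<longleftrightarrow>
     (\<exists>i j. i < dim_vec (snd Q) \<and> j < dim_vec (snd Q) \<and> i \<noteq> j \<and> R = linking i j Q)"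

(* Q' is the (k,l)-splitting of the m-node quiver Q at the nodes v 0, ..., v (n-1), where v is
   injective, with permutation \<sigma> of {..<n}, shifts h and factor \<kappa>. The new node belonging to
   v a has index m + a. The values of h on the chosen nodes are irrelevant. *)
fun is_splitting ::
  "nat \<Rightarrow> nat \<Rightarrow> (nat \<Rightarrow> nat) \<Rightarrow> (nat \<Rightarrow> nat) \<Rightarrow> (nat \<Rightarrow> int) \<Rightarrow> int \<Rightarrow> int \<Rightarrow>
   'p::comm_monoid_mult \<Rightarrow> 'p quiver \<Rightarrow> 'p quiver \<Rightarrow> bool" where
  "is_splitting m n v \<sigma> h k l \<kappa> (C, x) (C', x') \<longleftrightarrow>
     is_quiver (m + n) (C', x') \<and>
     (\<forall>i<m. x' $ i = x $ i) \<and>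
     (\<forall>a<n. x' $ (m + a) = \<kappa> * x $ v a) \<and>
     (\<forall>i<m. \<forall>j<m. C' $$ (i, j) = C $$ (i, j)) \<and>
     (\<forall>s<m. s \<notin> v ` {..<n} \<longrightarrow> (\<forall>a<n. C' $$ (s, m + a) = C $$ (s, v a) + h s)) \<and>
     (\<forall>a<n. C' $$ (v a, m + a) = C $$ (v a, v a) + k) \<and>
     (\<forall>a<n. \<forall>b<n. C' $$ (m + a, m + b) = C $$ (v a, v b) + l) \<and>
     (\<forall>a b. a < b \<and> b < n \<longrightarrow>
        (if \<sigma> a < \<sigma> b
         then C' $$ (v a, m + b) = C $$ (v a, v b) + k \<and>
              C' $$ (m + a, v b) = C $$ (v a, v b) + k + 1
         else C' $$ (v a, m + b) = C $$ (v a, v b) + k + 1 \<and>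
              C' $$ (m + a, v b) = C $$ (v a, v b) + k))"

(* The conditions in is_splitting are consistent; they also determine Q' uniquely. *)
lemma splitting_exists:
  fixes Q :: "'p::comm_monoid_mult quiver"
  assumes Q: "is_quiver m Q" and v: "inj_on v {..<n}" "v ` {..<n} \<subseteq> {..<m}"
    and \<sigma>: "\<sigma> permutes {..<n}"
  shows "\<exists>Q'. is_splitting m n v \<sigma> h k l \<kappa> Q Q'"
proof -
  obtain C x where Qe: "Q = (C, x)" by (cases Q)
  have sym: "C $$ (i,j) = C $$ (j,i)" if "i<m" "j<m" for i j
    using that Q unfolding Qe by (metis is_quiver.simps carrier_matD index_transpose_mat(1))
  have vm: "v a < m" if "a < n" for a using that v by auto
  define w where "w = the_inv_into {..<n} v"
  have w: "w (v a) = a" if "a < n" for a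
    unfolding w_def using that v by (simp add: the_inv_into_f_f)
  define D where "D s a = C $$ (s, v a) +
    (if s \<in> v ` {..<n}
     then if w s = a \<or> w s < a \<and> \<sigma> (w s) < \<sigma> a \<or> a < w s \<and> \<not> \<sigma> a < \<sigma> (w s) then k else k + 1
     else h s)" for s a
  define C' where "C' = mat (m+n) (m+n) (\<lambda>(s,t).
     if s < m \<and> t < m then C $$ (s,t)
     else if s < m then D s (t-m) else if t < m then D t (s-m)
     else C $$ (v (s-m), v (t-m)) + l)"
  define x' where "x' = vec (m+n) (\<lambda>s. if s < m then x $ s else \<kappa> * x $ v (s-m))"
  have "is_quiver (m+n) (C',x')"
    by (auto simp: C'_def x'_def sym vm)
  moreover have "C' $$ (i,j) = C $$ (i,j)" if "i < m" "j < m" for i j using that by (simp add: C'_def)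
  moreover have "C' $$ (s, m+a) = D s a" "C' $$ (m+a, s) = D s a" if "s < m" "a < n" for s a
    using that by (simp_all add: C'_def)
  moreover have "C' $$ (m+a,m+b) = C $$ (v a, v b) + l" if "a < n" "b < n" for a b
    using that by (simp add: C'_def)
  moreover have "D s a = C $$ (s, v a) + h s" if "s \<notin> v ` {..<n}" for s a
    using that by (simp add: D_def)
  moreover have "D (v a) b = C $$ (v a, v b) +
     (if a = b \<or> (a < b \<and> \<sigma> a < \<sigma> b) \<or> b < a \<and> \<not> \<sigma> b < \<sigma> a then k else k + 1)" if "a < n" "b < n" for a b
    using that w[of a] by (auto simp: D_def)
  ultimately have "is_splitting m n v \<sigma> h k l \<kappa> Q (C',x')"
    unfolding Qe by (auto simp: vm x'_def sym)
  then show ?thesis by blast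
qed

end

theory Submission
  imports Defs
begin

text \<open>
  Give the extra node the parameter \<open>\<kappa>\<close>, \<open>l - 2 * k\<close> loops, \<open>k\<close> arrows to every chosen node and
  \<open>h s\<close> arrows to every spectator \<open>s\<close>, and link it once with each chosen node, in the order of
  decreasing \<open>\<sigma>\<close>. Linking with \<open>v b\<close> adds a new node that sees every old node \<open>t\<close> through the sum of
  the arrows from \<open>t\<close> to \<open>v b\<close> and to the extra node. The latter number is \<open>k + 1\<close> if \<open>t\<close> is a chosen
  node that was linked before \<open>v b\<close>, and \<open>k\<close> if it is a chosen node linked later or \<open>v b\<close> itself:
  this is the asymmetry that \<open>\<sigma>\<close> prescribes. Two new nodes see each other through \<open>k\<close>
  arrows picked up by the earlier one and \<open>(l - 2 * k) + k\<close> arrows that it has to the extra node.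
\<close>

text \<open>The number of arrows between the extra node and an old node \<open>s\<close> after \<open>p\<close> linkings, where
  \<open>u 0, \<dots>, u (n - 1)\<close> are the chosen nodes in the order of linking.\<close>

definition extra_arrows ::
  "nat \<Rightarrow> (nat \<Rightarrow> nat) \<Rightarrow> (nat \<Rightarrow> int) \<Rightarrow> int \<Rightarrow> nat \<Rightarrow> nat \<Rightarrow> int" where
  "extra_arrows n u h k p s =
     (if s \<in> u ` {..<p} then k + 1 else if s \<in> u ` {..<n} then k else h s)"

text \<open>The extra node has index \<open>m\<close>, the node created by the linking with \<open>u q\<close> has index
  \<open>Suc (m + q)\<close>.\<close>

definition stage_entry ::
  "nat \<Rightarrow> nat \<Rightarrow> (nat \<Rightarrow> nat) \<Rightarrow> (nat \<Rightarrow> int) \<Rightarrow> int \<Rightarrow> int \<Rightarrow> int mat \<Rightarrow> nat \<Rightarrow> nat \<Rightarrow> nat \<Rightarrow> int" where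
  "stage_entry m n u h k l C p s t =
     (if s < m \<and> t < m then C $$ (s, t)
      else if s < m then
        (if t = m then extra_arrows n u h k p s
         else C $$ (s, u (t - Suc m)) + extra_arrows n u h k (t - Suc m) s)
      else if t < m then
        (if s = m then extra_arrows n u h k p t
         else C $$ (t, u (s - Suc m)) + extra_arrows n u h k (s - Suc m) t)
      else if s = m \<and> t = m then l - 2 * k
      else if s = m \<or> t = m then l - k
      else C $$ (u (s - Suc m), u (t - Suc m)) + l)"

text \<open>Closed form of the quiver after \<open>p\<close> linkings, which reduces each linking to
  an entrywise check. Among nodes already present only the arrows between the extra node and the old
  nodes still vary with \<open>p\<close>; a created node keeps the numbers it received at its
  creation.\<close>

definition stage ::
  "nat \<Rightarrow> nat \<Rightarrow> (nat \<Rightarrow> nat) \<Rightarrow> (nat \<Rightarrow> int) \<Rightarrow> int \<Rightarrow> int \<Rightarrow> 'p::comm_monoid_mult \<Rightarrow>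
   'p quiver \<Rightarrow> nat \<Rightarrow> 'p quiver" where
  "stage m n u h k l \<kappa> Q p =
     (mat (Suc (m + p)) (Suc (m + p)) (\<lambda>(s, t). stage_entry m n u h k l (fst Q) p s t),
      vec (Suc (m + p))
        (\<lambda>s. if s < m then snd Q $ s else if s = m then \<kappa> else \<kappa> * snd Q $ u (s - Suc m)))"

lemma is_quiver_sym:
  assumes "is_quiver m (C, x)" "i < m" "j < m"
  shows "C $$ (i, j) = C $$ (j, i)"
  using assms by (metis is_quiver.simps carrier_matD index_transpose_mat(1))

lemma extra_arrows_Suc:
  assumes "inj_on u {..<n}" "p < n"
  shows "extra_arrows n u h k (Suc p) s = extra_arrows n u h k p s + (if s = u p then 1 else 0)"
proof -
  have "u p \<notin> u ` {..<p}"
    using assms by (auto dest: inj_onD)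
  then show ?thesis
    using assms by (auto simp: extra_arrows_def lessThan_Suc)
qed

text \<open>The case \<open>q = p\<close> gives the loops of the node created from
  \<open>u p\<close> and its arrows to the extra node, the case \<open>q < p\<close> its arrows to
  the earlier created nodes.\<close>

lemma extra_arrows_unlinked:
  assumes "inj_on u {..<n}" "q \<le> p" "p < n"
  shows "extra_arrows n u h k q (u p) = k"
proof -
  have "u p \<notin> u ` {..<q}"
    using assms by (auto dest: inj_onD)
  then show ?thesis
    using assms by (auto simp: extra_arrows_def)
qed

lemma stage_0:
  assumes "is_quiver m Q"
  shows "add_node \<kappa> (l - 2 * k) (extra_arrows n u h k 0) Q = stage m n u h k l \<kappa> Q 0"
proof (cases Q)
  case (Pair C x)
  then have "dim_vec x = m"
    using assms by auto
  then show ?thesis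
    by (auto simp: Pair stage_def stage_entry_def Let_def intro!: eq_matI eq_vecI)
qed

lemma stage_Suc:
  assumes Q: "is_quiver m Q" and u: "inj_on u {..<n}" "u ` {..<n} \<subseteq> {..<m}" and p: "p < n"
  shows "linking m (u p) (stage m n u h k l \<kappa> Q p) = stage m n u h k l \<kappa> Q (Suc p)"
proof (cases Q)
  case (Pair C x)
  have um: "u q < m" if "q < n" for q
    using that u by auto
  note sym = is_quiver_sym[OF Q[unfolded Pair]]
  have up: "u p < m" "u p \<noteq> m" "u p < Suc (m + p)"
    using um[OF p] by auto
  let ?E = "stage_entry m n u h k l C"
  have raise: "?E (Suc p) s t = (if s = m \<and> t = u p \<or> s = u p \<and> t = m then ?E p s t + 1 else ?E p s t)"
    if "s < Suc (m + p)" "t < Suc (m + p)" for s t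
    using up that by (auto simp: stage_entry_def extra_arrows_Suc[OF u(1) p])
  \<comment> \<open>The right-hand sides are taken at stage \<open>p\<close> because a linking reads
    the matrix before it raises an entry. Hence the created node has \<open>k\<close>, not
    \<open>k + 1\<close>, additional arrows to \<open>u p\<close> itself.\<close>
  have new: "?E (Suc p) t (Suc (m + p)) = ?E p t m + ?E p t (u p)"
       "?E (Suc p) (Suc (m + p)) t = ?E p t m + ?E p t (u p)" if t: "t < Suc (m + p)" for t
  proof -
    consider "t < m" | "t = m" | q where "t = Suc (m + q)" "q < p"
      using t by (metis add_Suc add_less_cancel_left less_imp_Suc_add not_less_eq not_less_iff_gr_or_eq)
    then have "?E (Suc p) t (Suc (m + p)) = ?E p t m + ?E p t (u p)
       \<and> ?E (Suc p) (Suc (m + p)) t = ?E p t m + ?E p t (u p)"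
    proof cases
      case 3
      have "extra_arrows n u h k q (u p) = k"
        using 3 p u by (intro extra_arrows_unlinked) auto
      then show ?thesis
        using 3 up p by (simp add: stage_entry_def sym um)
    qed (use up p in \<open>simp_all add: stage_entry_def extra_arrows_unlinked[OF u(1)]\<close>)
    then show "?E (Suc p) t (Suc (m + p)) = ?E p t m + ?E p t (u p)"
       "?E (Suc p) (Suc (m + p)) t = ?E p t m + ?E p t (u p)" by auto
  qed
  \<comment> \<open>With \<open>c\<close> loops at the extra node the created node gains
    \<open>c + 2 * k\<close> loops over \<open>u p\<close>; equating this with \<open>l\<close>
    gives \<open>c = l - 2 * k\<close>.\<close>
  have loops: "?E (Suc p) (Suc (m + p)) (Suc (m + p)) = ?E p m m + ?E p (u p) (u p) + 2 * ?E p m (u p)"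
    using up p by (simp add: stage_entry_def extra_arrows_unlinked[OF u(1)])
  show ?thesis
    unfolding stage_def linking.simps add_node.simps Let_def Pair fst_conv snd_conv prod.inject
  proof (intro conjI eq_matI eq_vecI, goal_cases)
    case (1 s t)
    then consider "s < Suc (m + p)" "t < Suc (m + p)" | "s < Suc (m + p)" "t = Suc (m + p)"
      | "s = Suc (m + p)" "t < Suc (m + p)" | "s = Suc (m + p)" "t = Suc (m + p)"
      by fastforce
    then show ?case
      by cases (use up in \<open>simp_all add: new loops raise\<close>)
  qed (use up in \<open>auto simp: less_Suc_eq\<close>)
qed

lemma linking_steps_stage:
  assumes "is_quiver m Q" "inj_on u {..<n}" "u ` {..<n} \<subseteq> {..<m}" "p \<le> n"
  shows "linking_step\<^sup>*\<^sup>* (stage m n u h k l \<kappa> Q 0) (stage m n u h k l \<kappa> Q p)"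
  using assms(4)
proof (induction p)
  case (Suc p)
  have "u p < m"
    using assms(3) Suc.prems by (auto simp: image_subset_iff)
  then have "linking_step (stage m n u h k l \<kappa> Q p) (stage m n u h k l \<kappa> Q (Suc p))"
    unfolding linking_step_def using stage_Suc[OF assms(1-3), of p] Suc.prems
    by (intro exI[of _ m] exI[of _ "u p"]) (auto simp: stage_def)
  with Suc show ?case
    by (simp add: rtranclp.rtrancl_into_rtrancl)
qed simp

text \<open>Here \<open>\<tau> a\<close> is the position of \<open>v a\<close> in the order of
  linking, and \<open>anti\<close> says that this order reverses \<sigma>. The old nodes stay in
  place; only the new ones have to be rearranged, from the order of linking to that of
  \<open>v\<close>.\<close>

lemma remove_node_stage_iso_splitting:
  fixes Q Q' :: "'p::comm_monoid_mult quiver"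
  assumes Q: "is_quiver m Q" and v: "inj_on v {..<n}" "v ` {..<n} \<subseteq> {..<m}"
    and split: "is_splitting m n v \<sigma> h k l \<kappa> Q Q'"
    and \<tau>: "bij_betw \<tau> {..<n} {..<n}"
    and anti: "\<And>a b. a < n \<Longrightarrow> b < n \<Longrightarrow> \<tau> a < \<tau> b \<longleftrightarrow> \<sigma> b < \<sigma> a"
    and u: "\<And>a. a < n \<Longrightarrow> u (\<tau> a) = v a"
  shows "quiver_iso (remove_node m (stage m n u h k l \<kappa> Q n)) Q'"
proof -
  obtain C x where Qe: "Q = (C, x)" by (cases Q)
  obtain C' x' where Qe': "Q' = (C', x')" by (cases Q')
  note sp = split[unfolded Qe Qe' is_splitting.simps]
  have par_old: "x' $ i = x $ i" if "i < m" for i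
    using sp that by blast
  have par_new: "x' $ (m + a) = \<kappa> * x $ v a" if "a < n" for a
    using sp that by blast
  have old_old: "C' $$ (i, j) = C $$ (i, j)" if "i < m" "j < m" for i j
    using sp that by blast
  have spectator: "C' $$ (s, m + a) = C $$ (s, v a) + h s" if "s < m" "s \<notin> v ` {..<n}" "a < n" for s a
    using sp that by blast
  have diag: "C' $$ (v a, m + a) = C $$ (v a, v a) + k" if "a < n" for a
    using sp that by blast
  have new_new: "C' $$ (m + a, m + b) = C $$ (v a, v b) + l" if "a < n" "b < n" for a b
    using sp that by blast
  have cross: "C' $$ (v a, m + b) = C $$ (v a, v b) + (if \<sigma> a < \<sigma> b then k else k + 1)"
    "C' $$ (m + a, v b) = C $$ (v a, v b) + (if \<sigma> a < \<sigma> b then k + 1 else k)"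
    if "a < b" "b < n" for a b
    using sp that by (simp_all split: if_splits)
  have Q': "is_quiver (m + n) (C', x')"
    using sp by blast
  note symC' = is_quiver_sym[OF Q']
  note sym = is_quiver_sym[OF Q[unfolded Qe]]
  have vm: "v a < m" if "a < n" for a
    using that v by auto
  have \<tau>n: "\<tau> a < n" if "a < n" for a
    using that \<tau> by (auto dest: bij_betwE)
  have \<tau>_onto: "\<tau> ` {..<n} = {..<n}"
    using \<tau> by (rule bij_betw_imp_surj_on)
  have "u ` \<tau> ` {..<n} = v ` {..<n}"
    unfolding image_image by (rule image_cong) (auto simp: u)
  then have u_img: "u ` {..<n} = v ` {..<n}"
    unfolding \<tau>_onto .
  \<comment> \<open>This turns the order of linking into the inequality between values of \<sigma>
    that decides between \<open>k\<close> and \<open>k + 1\<close>.\<close>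
  have before: "v a \<in> u ` {..<\<tau> b} \<longleftrightarrow> \<sigma> b < \<sigma> a" if ab: "a < n" "b < n" for a b
  proof
    assume "v a \<in> u ` {..<\<tau> b}"
    then obtain q where q: "q < \<tau> b" "v a = u q" by auto
    moreover have "q < n" using q \<tau>n[OF ab(2)] by simp
    then obtain c where "c < n" "q = \<tau> c"
      using \<tau>_onto by (metis imageE lessThan_iff)
    ultimately show "\<sigma> b < \<sigma> a"
      using ab u[of c] v(1) anti[of c b] by (auto dest: inj_onD)
  next
    assume "\<sigma> b < \<sigma> a"
    then show "v a \<in> u ` {..<\<tau> b}"
      using ab anti[of a b] u[of a] by (intro image_eqI[of _ _ "\<tau> a"]) auto
  qed
  have old_new: "C' $$ (s, m + b) = C $$ (s, v b) + extra_arrows n u h k (\<tau> b) s"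
    if "s < m" "b < n" for s b
  proof (cases "s \<in> v ` {..<n}")
    case True
    then obtain a where a: "a < n" "s = v a" by auto
    consider "a = b" | "a < b" | "b < a" by linarith
    then show ?thesis
    proof cases
      case 1
      then show ?thesis
        using a that by (simp add: diag extra_arrows_def before u_img)
    next
      case 2
      \<comment> \<open>A tie would break the match: \<open>cross\<close> would give
        \<open>k + 1\<close>, but \<open>before\<close> only \<open>k\<close>. By
        \<open>anti\<close> it would force equal positions.\<close>
      have "\<sigma> a \<noteq> \<sigma> b"
      proof
        assume "\<sigma> a = \<sigma> b"
        then have "\<tau> a = \<tau> b"
          using anti[of a b] anti[of b a] a that by auto
        then show False
          using \<tau> a that 2 by (auto simp: bij_betw_def dest: inj_onD)
      qed
      then show ?thesis
        using a that 2 by (auto simp: cross extra_arrows_def before u_img)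
    next
      case 3
      have "C' $$ (v a, m + b) = C' $$ (m + b, v a)"
        using a that vm[of a] by (intro symC') auto
      then show ?thesis
        using a that 3 sym[OF vm[of a] vm[of b]]
        by (auto simp: cross extra_arrows_def before u_img)
    qed
  next
    case False
    moreover have "s \<notin> u ` {..<\<tau> b}"
      using False \<tau>n[OF that(2)] unfolding u_img[symmetric]
      by (meson image_mono lessThan_subset_iff less_imp_le subsetD)
    ultimately show ?thesis
      using that by (simp add: spectator extra_arrows_def u_img)
  qed
  \<comment> \<open>Once the extra node is removed, the node from the linking with
    \<open>u q\<close> has index \<open>m + q\<close>. Outside the node set \<pi> is the identity,
    as \<open>permutes\<close> demands.\<close>
  define \<pi> where "\<pi> i = (if i < m \<or> m + n \<le> i then i else m + \<tau> (i - m))" for i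
  have \<pi>_old: "\<pi> i = i" if "i < m" for i
    using that by (simp add: \<pi>_def)
  have \<pi>_new: "\<pi> (m + a) = m + \<tau> a" if "a < n" for a
    using that by (simp add: \<pi>_def)
  have node: "i < m \<or> (\<exists>a<n. i = m + a)" if "i < m + n" for i
    using that by (metis add_less_cancel_left le_Suc_ex linorder_not_less)
  have \<pi>_less: "\<pi> i < m + n" if "i < m + n" for i
    using node[OF that] \<tau>n by (auto simp: \<pi>_old \<pi>_new)
  have inj: "inj_on \<pi> {..<m + n}"
  proof (rule inj_onI)
    fix i j assume ij: "i \<in> {..<m + n}" "j \<in> {..<m + n}" and eq: "\<pi> i = \<pi> j"
    have \<tau>_eq: "\<tau> a = \<tau> b \<longleftrightarrow> a = b" if "a < n" "b < n" for a b
      using that bij_betw_imp_inj_on[OF \<tau>] by (simp add: inj_on_eq_iff)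
    have "i < m \<or> (\<exists>a<n. i = m + a)" "j < m \<or> (\<exists>a<n. j = m + a)"
      using ij by (simp_all add: node)
    then show "i = j"
      using eq by (elim disjE exE conjE) (simp_all add: \<pi>_old \<pi>_new \<tau>_eq)
  qed
  have "\<pi> ` {..<m + n} \<subseteq> {..<m + n}"
    using \<pi>_less by auto
  with inj have "bij_betw \<pi> {..<m + n} {..<m + n}"
    by (simp add: bij_betw_def endo_inj_surj)
  then have perm: "\<pi> permutes {..<m + n}"
    by (intro bij_imp_permutes) (auto simp: \<pi>_def)
  let ?E = "stage_entry m n u h k l C n"
  have new_old: "C' $$ (m + b, s) = C $$ (s, v b) + extra_arrows n u h k (\<tau> b) s"
    if "s < m" "b < n" for s b
    using symC'[of "m + b" s] old_new that by simp
  \<comment> \<open>\<open>insert_index m\<close> skips the extra node and so recovers the indices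
    used in \<open>stage_entry\<close>.\<close>
  have entry: "C' $$ (i, j) = ?E (insert_index m (\<pi> i)) (insert_index m (\<pi> j))"
    if ij: "i < m + n" "j < m + n" for i j
    using node[OF ij(1)] node[OF ij(2)]
    by (auto simp: \<pi>_old \<pi>_new insert_index_def stage_entry_def old_old old_new new_old new_new u)
  have par: "x' $ i = (let s = insert_index m (\<pi> i) in
       if s < m then x $ s else if s = m then \<kappa> else \<kappa> * x $ u (s - Suc m))"
    if i: "i < m + n" for i
    using node[OF i] by (auto simp: \<pi>_old \<pi>_new insert_index_def par_old par_new u)
  have ins: "insert_index m i < Suc (m + n)" if "i < m + n" for i
    using that by (auto simp: insert_index_def)
  have dims: "dim_row C' = m + n" "dim_col C' = m + n" "dim_vec x' = m + n"
    using Q' by auto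
  show ?thesis
    unfolding Qe' Qe stage_def remove_node.simps quiver_iso.simps fst_conv snd_conv
  proof (intro conjI exI[of _ \<pi>], goal_cases)
    case 4
    show ?case
      by (rule eq_matI)
        (auto simp: dims entry mat_delete_def insert_index_def \<pi>_less less_SucI)
  next
    case 5
    show ?case
      by (rule eq_vecI) (auto simp: dims par ins \<pi>_less Let_def)
  qed (auto simp: perm mat_delete_def)
qed

theorem proposition3p5:
  fixes Q Q' :: "'p::comm_monoid_mult quiver"
    and m n :: nat and v \<sigma> :: "nat \<Rightarrow> nat"
    and h :: "nat \<Rightarrow> int" and k l :: int and \<kappa> :: 'p
  assumes "is_quiver m Q"
    and "inj_on v {..<n}" and "v ` {..<n} \<subseteq> {..<m}"
    and "\<sigma> permutes {..<n}"
    and "is_splitting m n v \<sigma> h k l \<kappa> Q Q'"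
  shows "\<exists>y c d R. linking_step\<^sup>*\<^sup>* (add_node y c d Q) R \<and>
           quiver_iso (remove_node m R) Q'"
proof -
  \<comment> \<open>Positions count from 0, so the largest value \<open>n - 1\<close> of \<sigma> is
    linked first.\<close>
  define \<tau> where "\<tau> a = n - Suc (\<sigma> a)" for a
  have \<sigma>n: "\<sigma> a < n" if "a < n" for a
    using that assms(4) permutes_in_image by fastforce
  have inj: "inj_on \<tau> {..<n}"
  proof (rule inj_onI)
    fix a b assume ab: "a \<in> {..<n}" "b \<in> {..<n}" "\<tau> a = \<tau> b"
    then have "\<sigma> a = \<sigma> b"
      using \<sigma>n[of a] \<sigma>n[of b] by (auto simp: \<tau>_def)
    then show "a = b"
      using permutes_inj[OF assms(4)] by (auto dest: injD)
  qed
  have "\<tau> ` {..<n} \<subseteq> {..<n}"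
    by (auto simp: \<tau>_def)
  with inj have \<tau>: "bij_betw \<tau> {..<n} {..<n}"
    by (simp add: bij_betw_def endo_inj_surj)
  define u where "u = v \<circ> inv_into {..<n} \<tau>"
  have u\<tau>: "u (\<tau> a) = v a" if "a < n" for a
    using that \<tau> by (simp add: u_def bij_betw_def)
  have inv: "bij_betw (inv_into {..<n} \<tau>) {..<n} {..<n}"
    using \<tau> by (rule bij_betw_inv_into)
  have u: "inj_on u {..<n}" "u ` {..<n} \<subseteq> {..<m}"
    using inv assms(2,3) by (auto simp: u_def bij_betw_def comp_inj_on image_comp[symmetric])
  have "linking_step\<^sup>*\<^sup>* (add_node \<kappa> (l - 2 * k) (extra_arrows n u h k 0) Q)
      (stage m n u h k l \<kappa> Q n)"
    unfolding stage_0[OF assms(1)] by (rule linking_steps_stage[OF assms(1) u]) simp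
  moreover have "quiver_iso (remove_node m (stage m n u h k l \<kappa> Q n)) Q'"
  proof (rule remove_node_stage_iso_splitting[OF assms(1-3,5) \<tau> _ u\<tau>])
    show "\<tau> a < \<tau> b \<longleftrightarrow> \<sigma> b < \<sigma> a" if "a < n" "b < n" for a b
      using \<sigma>n[OF that(1)] \<sigma>n[OF that(2)] by (auto simp: \<tau>_def)
  qed
  ultimately show ?thesis
    by blast
qed

end
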